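(* Let $\mathscr H$ be a complex Hilbert space with $\dim\mathscr H<\infty$ and let $\mathfrak M:=\{A^{(1)},\ldots,A^{(n)}\}$ be a finite set of nonnegative Hermitian matrices (positive operators on $\mathscr H$). Let $S$ denote the parallel sum of the operators $A^{(1)},\ldots,A^{(n)}$ and set $$\widetilde{\mathfrak M}:=\{[S]A^{(j)}:j=1,\ldots,n\}.$$ The set $\mathfrak L^{+}$ of all positive lower bounds of $\mathfrak M$ has a greatest element if and only if the set $\widetilde{\mathfrak M}$ has a greatest lower bound.
   Context: $\mathfrak S$ denotes the real vector space of bounded self-adjoint operators on $\mathscr H$, with Löwner's order: $S\le T$ iff $(Su,u)\le (Tu,u)$ for all $u\in\mathscr H$; $S$ is positive if $S\ge0$. An operator $L\in\mathfrak S$ is a lower bound of a set if $L\le A$ for all its elements $A$. $\mathfrak L^{+}=\{L\in\mathfrak S:L\ge0,\ L\le A^{(j)},\ j=1,\dots,n\}$. The greatest lower bound (infimum) of $\widetilde{\mathfrak M}$ is the greatest element of the set of all its (not necessarily positive) lower bounds in $\mathfrak S$; a greatest element of a subset is an element of it that dominates all its elements. For positive $A,B$ the parallel sum $A:B$ is the positive operator determined by $((A:B)u,u)=\inf\{(Av,v)+(B(u-v),u-v):v\in\mathscr H\}$, $u\in\mathscr H$; this operation is commutative and associative, and the parallel sum of $n$ operators is $A^{(1)}:A^{(2)}:\cdots:A^{(n)}$ (equal to $A^{(1)}$ if $n=1$). For positive $A,B$, $[A]B:=\lim_{m\to\infty}(mA):B$, a limit which exists in the strong-operator topology. *)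

theory Defs
  imports "HOL-Analysis.Analysis"
begin

section \<open>Complex Hilbert spaces\<close>

text \<open>
  The inner product is linear in its first argument. The real part of the inner product is the
  inner product of the underlying real space; hence positive definiteness and the norm
  \<open>norm x = sqrt (Re (cinner x x))\<close> come from the class \<open>real_inner\<close>.
\<close>

class complex_hilbert_space = real_inner + complete_space +
  fixes scaleC :: "complex \<Rightarrow> 'a \<Rightarrow> 'a" (infixr \<open>*\<^sub>C\<close> 75)
    and cinner :: "'a \<Rightarrow> 'a \<Rightarrow> complex"
  assumes scaleC_add_right: "c *\<^sub>C (x + y) = c *\<^sub>C x + c *\<^sub>C y"
    and scaleC_add_left: "(c + d) *\<^sub>C x = c *\<^sub>C x + d *\<^sub>C x"
    and scaleC_scaleC: "c *\<^sub>C d *\<^sub>C x = (c * d) *\<^sub>C x"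
    and scaleR_scaleC: "r *\<^sub>R x = complex_of_real r *\<^sub>C x"
    and cinner_commute: "cinner x y = cnj (cinner y x)"
    and cinner_add_left: "cinner (x + y) z = cinner x z + cinner y z"
    and cinner_scaleC_left: "cinner (c *\<^sub>C x) y = c * cinner x y"
    and inner_eq_Re_cinner: "x \<bullet> y = Re (cinner x y)"

global_interpretation complex_vector:
  vector_space "scaleC :: complex \<Rightarrow> 'a \<Rightarrow> 'a::complex_hilbert_space"
proof
  fix x :: 'a
  show "1 *\<^sub>C x = x"
    using scaleR_scaleC[of 1 x] by simp
qed (simp_all add: scaleC_add_right scaleC_add_left scaleC_scaleC)

text \<open>The standard models \<open>\<complex>\<close> and \<open>\<complex>\<^sup>n\<close> (the latter for \<open>n \<ge> 1\<close>).\<close>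

instantiation complex :: complex_hilbert_space
begin

definition scaleC_complex :: "complex \<Rightarrow> complex \<Rightarrow> complex"
  where "scaleC_complex c x = c * x"

definition cinner_complex :: "complex \<Rightarrow> complex \<Rightarrow> complex"
  where "cinner_complex x y = x * cnj y"

instance
  by standard
    (simp_all add: scaleC_complex_def cinner_complex_def inner_complex_def scaleR_conv_of_real
      algebra_simps)

end

instantiation vec :: (complex_hilbert_space, finite) complex_hilbert_space
begin

definition scaleC_vec :: "complex \<Rightarrow> 'a ^ 'b \<Rightarrow> 'a ^ 'b"
  where "scaleC_vec c x = (\<chi> i. c *\<^sub>C x $ i)"

definition cinner_vec :: "'a ^ 'b \<Rightarrow> 'a ^ 'b \<Rightarrow> complex"
  where "cinner_vec x y = (\<Sum>i\<in>UNIV. cinner (x $ i) (y $ i))"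

instance
proof
  fix x y :: "'a ^ 'b"
  have "cnj (cinner (y $ i) (x $ i)) = cinner (x $ i) (y $ i)" for i
    using cinner_commute[of "x $ i" "y $ i"] by simp
  then show "cinner x y = cnj (cinner y x)"
    by (simp add: cinner_vec_def)
qed (simp_all add: scaleC_vec_def cinner_vec_def inner_vec_def vec_eq_iff scaleC_add_right
    scaleC_add_left scaleR_scaleC cinner_add_left cinner_scaleC_left inner_eq_Re_cinner
    sum.distrib sum_distrib_left)

end

section \<open>Self-adjoint operators and the Loewner order\<close>

definition selfadjoint_op :: "('a::complex_hilbert_space \<Rightarrow> 'a) \<Rightarrow> bool" where
  "selfadjoint_op A \<longleftrightarrow> bounded_linear A \<and> (\<forall>c x. A (c *\<^sub>C x) = c *\<^sub>C A x) \<and>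
     (\<forall>x y. cinner (A x) y = cinner x (A y))"

text \<open>For self-adjoint \<open>S\<close> the number \<open>cinner (S u) u\<close> is real, so \<open>Re\<close> only changes its type.\<close>

definition quad :: "('a::complex_hilbert_space \<Rightarrow> 'a) \<Rightarrow> 'a \<Rightarrow> real" where
  "quad S u = Re (cinner (S u) u)"

definition loewner_le :: "('a::complex_hilbert_space \<Rightarrow> 'a) \<Rightarrow> ('a \<Rightarrow> 'a) \<Rightarrow> bool"
    (infix \<open>\<sqsubseteq>\<close> 50) where
  "S \<sqsubseteq> T \<longleftrightarrow> (\<forall>u. quad S u \<le> quad T u)"

definition positive_op :: "('a::complex_hilbert_space \<Rightarrow> 'a) \<Rightarrow> bool" where
  "positive_op A \<longleftrightarrow> selfadjoint_op A \<and> (\<lambda>_. 0) \<sqsubseteq> A"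

definition lower_bounds :: "('a::complex_hilbert_space \<Rightarrow> 'a) set \<Rightarrow> ('a \<Rightarrow> 'a) set" where
  "lower_bounds \<A> = {L. selfadjoint_op L \<and> (\<forall>A\<in>\<A>. L \<sqsubseteq> A)}"

definition positive_lower_bounds ::
    "('a::complex_hilbert_space \<Rightarrow> 'a) set \<Rightarrow> ('a \<Rightarrow> 'a) set" where
  "positive_lower_bounds \<A> = {L. positive_op L \<and> (\<forall>A\<in>\<A>. L \<sqsubseteq> A)}"

definition is_greatest_element ::
    "('a::complex_hilbert_space \<Rightarrow> 'a) \<Rightarrow> ('a \<Rightarrow> 'a) set \<Rightarrow> bool" where
  "is_greatest_element G \<L> \<longleftrightarrow> G \<in> \<L> \<and> (\<forall>L\<in>\<L>. L \<sqsubseteq> G)"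

definition is_infimum ::
    "('a::complex_hilbert_space \<Rightarrow> 'a) \<Rightarrow> ('a \<Rightarrow> 'a) set \<Rightarrow> bool" where
  "is_infimum G \<A> \<longleftrightarrow> is_greatest_element G (lower_bounds \<A>)"

section \<open>Parallel sums\<close>

text \<open>Meaningful for positive \<open>A\<close> and \<open>B\<close> only.\<close>

definition parallel_sum ::
    "('a::complex_hilbert_space \<Rightarrow> 'a) \<Rightarrow> ('a \<Rightarrow> 'a) \<Rightarrow> 'a \<Rightarrow> 'a" (infixl \<open>\<parallel>\<close> 70) where
  "A \<parallel> B = (THE C. positive_op C \<and> (\<forall>u. quad C u = (INF v. quad A v + quad B (u - v))))"

text \<open>\<open>A 1 \<parallel> A 2 \<parallel> \<dots> \<parallel> A n\<close>, associated to the left, for \<open>n \<ge> 1\<close>.\<close>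

definition parallel_sum_upto ::
    "nat \<Rightarrow> (nat \<Rightarrow> 'a::complex_hilbert_space \<Rightarrow> 'a) \<Rightarrow> 'a \<Rightarrow> 'a" where
  "parallel_sum_upto n A = foldl (\<parallel>) (A 1) (map A [2..<Suc n])"

text \<open>The operator \<open>[A]B\<close>. A limit in the strong operator topology is a pointwise limit in norm.\<close>

definition parallel_limit ::
    "('a::complex_hilbert_space \<Rightarrow> 'a) \<Rightarrow> ('a \<Rightarrow> 'a) \<Rightarrow> 'a \<Rightarrow> 'a" where
  "parallel_limit A B = (\<lambda>u. lim (\<lambda>m::nat. ((\<lambda>x. real m *\<^sub>R A x) \<parallel> B) u))"

end

theory Submission
  imports Defs
begin

text \<open>
  Write \<open>T j\<close> for \<open>[S]A j\<close>. Passing from the operators \<open>A j\<close> to the operators \<open>T j\<close> does not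
  change the positive lower bounds. Indeed, \<open>T j \<le> A j\<close>; conversely, a positive lower bound \<open>L\<close> of
  all \<open>A j\<close> satisfies \<open>L \<le> n S\<close>, because the parallel sum is monotone and the parallel sum of \<open>n\<close>
  copies of \<open>L\<close> is \<open>L / n\<close>, and \<open>[S]B\<close> dominates every positive operator below \<open>B\<close> that is below a
  multiple of \<open>S\<close> (lemma \<open>parallel_limit_greatest\<close>). So the claim is about the \<open>T j\<close> alone: their
  positive lower bounds have a greatest element iff all their self-adjoint lower bounds do.

  If \<open>G\<close> is the infimum of the \<open>T j\<close>, then \<open>G \<ge> 0\<close> as \<open>0\<close> is a lower bound, so \<open>G\<close> is also the
  greatest positive lower bound.

  Conversely, let \<open>G\<close> be the greatest positive lower bound (lemma
  \<open>greatest_positive_imp_infimum\<close>). Since \<open>S\<close> itself is a positive lower bound, \<open>G \<ge> S\<close>. But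
  \<open>G\<close> vanishes on \<open>ker S\<close>, like the \<open>T j\<close>, and adding a small multiple of an operator that does
  not vanish there may destroy positivity; so a self-adjoint lower bound \<open>L\<close> is first replaced
  by a lower bound \<open>L' \<ge> L\<close> that vanishes on \<open>ker S\<close>, namely
  \<open>quad L' u = sup {quad L (u + y) | y \<in> ker S}\<close>. It equals \<open>T k - C\<close> for any \<open>k\<close>, where \<open>C\<close> is
  the shorted operator of \<open>T k - L\<close>, obtained by minimizing the quadratic form over the cosets of
  \<open>ker S\<close>. In finite dimension, \<open>C\<close> is below a multiple \<open>K S\<close> (lemma \<open>psd_dominated\<close>), so
  \<open>L' \<ge> - K S\<close>, and for \<open>t = 1 / (1 + K)\<close> the convex combination \<open>(1 - t) G + t L'\<close> is a positive
  lower bound. It is thus below \<open>G\<close>, which gives \<open>L \<le> L' \<le> G\<close>.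

  The operators that enter, parallel sums and shorted operators, both come from minimizing a
  positive semidefinite form over the cosets of a finite-dimensional subspace (lemma
  \<open>psd_partial_minimum\<close>).
\<close>

section \<open>Positive semidefinite maps on real inner product spaces\<close>

text \<open>
  The form \<open>quad A\<close> only involves the real inner product, so the minimization arguments need
  no complex scalars. Over the reals, products such as \<open>'a \<times> 'a\<close> are again inner product spaces.
\<close>

definition psd :: "('b::real_inner \<Rightarrow> 'b) \<Rightarrow> bool" where
  "psd D \<longleftrightarrow> linear D \<and> (\<forall>x y. D x \<bullet> y = x \<bullet> D y) \<and> (\<forall>x. 0 \<le> D x \<bullet> x)"

lemma psdD:
  assumes "psd D"
  shows "linear D" "D x \<bullet> y = x \<bullet> D y" "0 \<le> D x \<bullet> x"
    "D (x + y) = D x + D y" "D (x - y) = D x - D y" "D (r *\<^sub>R x) = r *\<^sub>R D x" "D 0 = 0"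
proof -
  show l: "linear D" and "D x \<bullet> y = x \<bullet> D y" "0 \<le> D x \<bullet> x"
    using assms by (auto simp: psd_def)
  show "D (x + y) = D x + D y" "D (x - y) = D x - D y" "D (r *\<^sub>R x) = r *\<^sub>R D x" "D 0 = 0"
    using l by (simp_all add: linear_add linear_diff linear_cmul linear_0)
qed

lemma psd_expand:
  assumes "psd D"
  shows "D (x + y) \<bullet> (x + y) = D x \<bullet> x + 2 * (D x \<bullet> y) + D y \<bullet> y"
  using psdD(2)[OF assms, of y x]
  by (simp add: psdD[OF assms] inner_add inner_commute)

lemma psd_expand_scaled:
  assumes "psd D"
  shows "D (x + r *\<^sub>R y) \<bullet> (x + r *\<^sub>R y) = D x \<bullet> x + 2 * r * (D x \<bullet> y) + r\<^sup>2 * (D y \<bullet> y)"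
  unfolding psd_expand[OF assms] psdD(6)[OF assms] by (simp add: power2_eq_square)

lemma psd_Cauchy_Schwarz:
  assumes "psd D"
  shows "(D x \<bullet> y)\<^sup>2 \<le> (D x \<bullet> x) * (D y \<bullet> y)"
proof -
  have pos: "0 \<le> D x \<bullet> x + 2 * r * (D x \<bullet> y) + r\<^sup>2 * (D y \<bullet> y)" for r
    using psdD(3)[OF assms, of "x + r *\<^sub>R y"] unfolding psd_expand_scaled[OF assms] .
  show ?thesis
  proof (cases "D y \<bullet> y = 0")
    case True
    have "D x \<bullet> y = 0"
    proof (rule ccontr)
      \<comment> \<open>The quadratic polynomial in \<open>pos\<close> is then affine and not constant, and takes the value \<open>-1\<close>.\<close>
      assume nz: "D x \<bullet> y \<noteq> 0"
      show False
        using pos[of "- (D x \<bullet> x + 1) / (2 * (D x \<bullet> y))"] nz True by (simp add: field_simps)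
    qed
    then show ?thesis using True by simp
  next
    case False
    with psdD(3)[OF assms, of y] have y: "D y \<bullet> y > 0" by simp
    have "0 \<le> D x \<bullet> x - (D x \<bullet> y)\<^sup>2 / (D y \<bullet> y)"
      using pos[of "- (D x \<bullet> y) / (D y \<bullet> y)"] y by (simp add: field_simps power2_eq_square)
    then show ?thesis using y by (simp add: field_simps)
  qed
qed

lemma psd_null:
  assumes "psd D" "D x \<bullet> x = 0"
  shows "D x = 0"
  using psd_Cauchy_Schwarz[OF assms(1), of x "D x"] assms(2) by simp

lemma psd_add_null:
  assumes "psd D" "D y \<bullet> y = 0"
  shows "D (x + y) \<bullet> (x + y) = D x \<bullet> x"
  using psd_null[OF assms] psdD(2)[OF assms(1), of x y] psd_expand[OF assms(1), of x y] by simp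

text \<open>
  Gram-Schmidt orthogonalization for the semi-inner product of \<open>D\<close>: the projection onto
  \<open>span (insert b B)\<close> is the one onto \<open>span B\<close> corrected along the component of \<open>b\<close> that is
  \<open>D\<close>-orthogonal to \<open>span B\<close>.
\<close>

lemma psd_projection:
  assumes D: "psd D" and "finite B"
  shows "\<exists>y\<in>span B. \<forall>x\<in>span B. D (u - y) \<bullet> x = 0"
  using \<open>finite B\<close>
proof (induction B arbitrary: u)
  case empty
  then show ?case by simp
next
  case (insert b B)
  obtain y where y: "y \<in> span B" "\<forall>x\<in>span B. D (u - y) \<bullet> x = 0"
    using insert.IH by blast
  obtain z where z: "z \<in> span B" "\<forall>x\<in>span B. D (b - z) \<bullet> x = 0"
    using insert.IH by blast
  define b' where "b' = b - z"
  define r where "r = (D (u - y) \<bullet> b') / (D b' \<bullet> b')"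
  \<comment> \<open>If \<open>b'\<close> is null, then \<open>D b' = 0\<close> and the division by zero in \<open>r\<close> does no harm.\<close>
  have r: "D (u - y) \<bullet> b' = r * (D b' \<bullet> b')"
    using psd_null[OF D, of b'] psdD(2)[OF D, of "u - y" b'] by (cases "D b' \<bullet> b' = 0") (auto simp: r_def)
  have sub: "span B \<subseteq> span (insert b B)"
    by (rule span_mono) auto
  have b': "b' \<in> span (insert b B)"
    unfolding b'_def using z(1) sub by (meson insertI1 span_base span_diff subsetD)
  have "y + r *\<^sub>R b' \<in> span (insert b B)"
    using y(1) sub b' by (meson span_add span_scale subsetD)
  moreover have "D (u - (y + r *\<^sub>R b')) \<bullet> x = 0" if "x \<in> span (insert b B)" for x
  proof -
    obtain k where k: "x - k *\<^sub>R b \<in> span B"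
      using \<open>x \<in> span (insert b B)\<close> by (auto simp: span_insert)
    define w where "w = x - k *\<^sub>R b + k *\<^sub>R z"
    have w: "w \<in> span B" unfolding w_def using k z(1) by (meson span_add span_scale)
    have x: "x = w + k *\<^sub>R b'" by (simp add: w_def b'_def algebra_simps)
    have "D (u - (y + r *\<^sub>R b')) = D (u - y) - r *\<^sub>R D b'"
      by (simp add: psdD(4-6)[OF D])
    moreover have "D (u - y) \<bullet> w = 0" "D b' \<bullet> w = 0"
      using w y(2) z(2) by (auto simp: b'_def)
    ultimately show ?thesis
      using r by (simp add: x inner_add_right inner_diff_left)
  qed
  ultimately show ?case by blast
qed

text \<open>
  Induction along an \<open>S\<close>-orthogonal basis: on each new basis vector \<open>b'\<close> the hypothesis on null
  vectors bounds \<open>C\<close> by a multiple of \<open>S\<close>. The form of \<open>S\<close> is additive over the orthogonal parts and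
  that of \<open>C\<close> is subadditive up to the factor \<open>2\<close>.
\<close>

lemma psd_dominated:
  assumes S: "psd S" and C: "psd C" and null: "\<And>u. S u \<bullet> u = 0 \<Longrightarrow> C u \<bullet> u = 0"
    and "finite B"
  shows "\<exists>K\<ge>0. \<forall>u\<in>span B. C u \<bullet> u \<le> K * (S u \<bullet> u)"
  using \<open>finite B\<close>
proof induction
  case empty
  then show ?case by (auto simp: psdD(7)[OF C])
next
  case (insert b B)
  obtain K where K: "K \<ge> 0" "\<forall>u\<in>span B. C u \<bullet> u \<le> K * (S u \<bullet> u)"
    using insert.IH by blast
  obtain z where z: "z \<in> span B" "\<forall>x\<in>span B. S (b - z) \<bullet> x = 0"
    using psd_projection[OF S \<open>finite B\<close>] by blast
  define b' where "b' = b - z"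
  \<comment> \<open>If \<open>b'\<close> is \<open>S\<close>-null, it is \<open>C\<close>-null too, and the value \<open>0\<close> of the quotient is right.\<close>
  define k where "k = (C b' \<bullet> b') / (S b' \<bullet> b')"
  have k: "C b' \<bullet> b' = k * (S b' \<bullet> b')" "k \<ge> 0"
    using null[of b'] psdD(3)[OF C, of b'] psdD(3)[OF S, of b'] by (auto simp: k_def)
  have "C u \<bullet> u \<le> 2 * (K + k) * (S u \<bullet> u)" if "u \<in> span (insert b B)" for u
  proof -
    obtain r where r: "u - r *\<^sub>R b \<in> span B"
      using \<open>u \<in> span (insert b B)\<close> by (auto simp: span_insert)
    define w where "w = u - r *\<^sub>R b + r *\<^sub>R z"
    have w: "w \<in> span B" unfolding w_def using r z(1) by (meson span_add span_scale)
    have u: "u = w + r *\<^sub>R b'" by (simp add: w_def b'_def algebra_simps)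
    have "S b' \<bullet> w = 0" using w z(2) by (auto simp: b'_def)
    then have "S w \<bullet> b' = 0" using psdD(2)[OF S, of w b'] by (simp add: inner_commute)
    then have Su: "S u \<bullet> u = S w \<bullet> w + r\<^sup>2 * (S b' \<bullet> b')"
      unfolding u psd_expand_scaled[OF S] by simp
    have "0 \<le> C (w + (- r) *\<^sub>R b') \<bullet> (w + (- r) *\<^sub>R b')"
      by (rule psdD(3)[OF C])
    then have "C u \<bullet> u \<le> 2 * (C w \<bullet> w) + 2 * (r\<^sup>2 * (C b' \<bullet> b'))"
      unfolding u psd_expand_scaled[OF C] by (simp add: algebra_simps)
    also have "\<dots> \<le> 2 * (K * (S w \<bullet> w)) + 2 * (k * (r\<^sup>2 * (S b' \<bullet> b')))"
      using K(2) w k(1) by (simp add: mult.left_commute)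
    also have "\<dots> \<le> 2 * ((K + k) * (S w \<bullet> w)) + 2 * ((K + k) * (r\<^sup>2 * (S b' \<bullet> b')))"
      using K(1) k(2) psdD(3)[OF S, of w] psdD(3)[OF S, of b']
      by (intro add_mono mult_left_mono mult_right_mono) auto
    finally show ?thesis by (simp add: Su algebra_simps)
  qed
  with K(1) k(2) show ?case by (intro exI[of _ "2 * (K + k)"]) auto
qed

text \<open>
  The minimum over \<open>J u + span B\<close> is attained where \<open>D (J u + y)\<close> is orthogonal to \<open>span B\<close>. With
  \<open>y = Y u\<close> chosen so, \<open>C = J' \<circ> D \<circ> (J + Y)\<close> satisfies
  \<open>C u \<bullet> v = D (J u + Y u) \<bullet> (J v + Y v)\<close>. This is symmetric in \<open>u\<close> and \<open>v\<close>, which makes \<open>C\<close>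
  linear although \<open>Y\<close> need not be. The map \<open>J\<close> with adjoint \<open>J'\<close> allows \<open>D\<close> to live on another
  space than \<open>C\<close>.
\<close>

lemma psd_partial_minimum:
  fixes D :: "'e::real_inner \<Rightarrow> 'e" and J :: "'b::real_inner \<Rightarrow> 'e"
  assumes D: "psd D" and "finite B" and adj: "\<And>p u. J' p \<bullet> u = p \<bullet> J u"
  obtains C where "psd C"
    "\<And>u. \<exists>y\<in>span B. C u \<bullet> u = D (J u + y) \<bullet> (J u + y)"
    "\<And>u y. y \<in> span B \<Longrightarrow> C u \<bullet> u \<le> D (J u + y) \<bullet> (J u + y)"
proof -
  have "\<exists>y. y \<in> span B \<and> (\<forall>x\<in>span B. D (J u + y) \<bullet> x = 0)" for u
    using psd_projection[OF D \<open>finite B\<close>, of "J u"]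
    by (metis add_uminus_conv_diff span_neg)
  then obtain Y where Y: "\<And>u. Y u \<in> span B" "\<And>u x. x \<in> span B \<Longrightarrow> D (J u + Y u) \<bullet> x = 0"
    by metis
  define C where "C = (\<lambda>u. J' (D (J u + Y u)))"
  have C: "C u \<bullet> v = D (J u + Y u) \<bullet> (J v + Y v)" for u v
    using Y by (simp add: C_def adj inner_add_right)
  have sym: "C u \<bullet> v = u \<bullet> C v" for u v
    using C psdD(2)[OF D] by (metis inner_commute)
  have "linear C"
  proof (rule linearI)
    show "C (u + v) = C u + C v" for u v
      by (rule vector_eq_ldot[THEN iffD1]) (metis sym inner_commute inner_add_right)
    show "C (r *\<^sub>R u) = r *\<^sub>R C u" for r u
      by (rule vector_eq_ldot[THEN iffD1]) (metis sym inner_scaleR_right)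
  qed
  moreover have "0 \<le> C u \<bullet> u" for u by (simp add: C psdD(3)[OF D])
  ultimately have "psd C" unfolding psd_def using sym by blast
  moreover have "\<exists>y\<in>span B. C u \<bullet> u = D (J u + y) \<bullet> (J u + y)" for u
    using C Y(1) by blast
  moreover have "C u \<bullet> u \<le> D (J u + y) \<bullet> (J u + y)" if "y \<in> span B" for u y
  proof -
    have "D (J u + Y u) \<bullet> (y - Y u) = 0"
      using Y that by (simp add: span_diff)
    then show ?thesis
      using psd_expand[OF D, of "J u + Y u" "y - Y u"] psdD(3)[OF D, of "y - Y u"]
      by (simp add: C)
  qed
  ultimately show ?thesis using that by blast
qed

section \<open>Positive operators as real forms\<close>

lemma quad_inner: "quad S u = S u \<bullet> u"
  by (simp add: quad_def inner_eq_Re_cinner)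

lemma inner_i: "(\<i> *\<^sub>C x) \<bullet> (\<i> *\<^sub>C y) = x \<bullet> y"
proof -
  have "cinner (\<i> *\<^sub>C x) (\<i> *\<^sub>C y) = \<i> * cinner x (\<i> *\<^sub>C y)"
    by (rule cinner_scaleC_left)
  also have "cinner x (\<i> *\<^sub>C y) = cnj (cinner (\<i> *\<^sub>C y) x)"
    by (rule cinner_commute)
  also have "cinner (\<i> *\<^sub>C y) x = \<i> * cinner y x"
    by (rule cinner_scaleC_left)
  also have "\<i> * cnj (\<i> * cinner y x) = cnj (cinner y x)" by simp
  also have "\<dots> = cinner x y" by (rule cinner_commute[symmetric])
  finally show ?thesis by (simp add: inner_eq_Re_cinner)
qed

lemma i_i: "\<i> *\<^sub>C \<i> *\<^sub>C x = - x"
  using scaleR_scaleC[of "-1" x] by (simp add: scaleC_scaleC)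

lemma scaleC_Re_Im: "c *\<^sub>C x = Re c *\<^sub>R x + Im c *\<^sub>R \<i> *\<^sub>C x"
proof -
  have "c *\<^sub>C x = (complex_of_real (Re c) + complex_of_real (Im c) * \<i>) *\<^sub>C x"
    by (simp add: complex_eq_iff)
  then show ?thesis by (simp only: scaleC_add_left scaleC_scaleC scaleR_scaleC)
qed

lemma Im_cinner: "Im (cinner x y) = - ((\<i> *\<^sub>C x) \<bullet> y)"
  by (simp add: inner_eq_Re_cinner cinner_scaleC_left)

lemma selfadjoint_opI:
  assumes "bounded_linear C" "\<And>x y. C x \<bullet> y = x \<bullet> C y" "\<And>x. C (\<i> *\<^sub>C x) = \<i> *\<^sub>C C x"
  shows "selfadjoint_op C"
  unfolding selfadjoint_op_def
proof (intro conjI allI)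
  interpret bounded_linear C by fact
  show "bounded_linear C" by fact
  show "C (c *\<^sub>C x) = c *\<^sub>C C x" for c x
    by (subst (1 2) scaleC_Re_Im) (simp add: add scaleR assms(3))
  show "cinner (C x) y = cinner x (C y)" for x y
  proof (rule complex_eqI)
    show "Re (cinner (C x) y) = Re (cinner x (C y))"
      using assms(2) by (simp flip: inner_eq_Re_cinner)
    show "Im (cinner (C x) y) = Im (cinner x (C y))"
      using assms(2)[of "\<i> *\<^sub>C x" y] assms(3) by (simp add: Im_cinner)
  qed
qed

lemma selfadjoint_opD:
  assumes "selfadjoint_op A"
  shows "bounded_linear A" "A x \<bullet> y = x \<bullet> A y" "A (\<i> *\<^sub>C x) = \<i> *\<^sub>C A x"
  using assms by (auto simp: selfadjoint_op_def inner_eq_Re_cinner)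

lemma selfadjoint_op_combination:
  assumes A: "selfadjoint_op A" and B: "selfadjoint_op B"
  shows "selfadjoint_op (\<lambda>x. a *\<^sub>R A x + b *\<^sub>R B x)"
proof (rule selfadjoint_opI)
  show "bounded_linear (\<lambda>x. a *\<^sub>R A x + b *\<^sub>R B x)"
    using selfadjoint_opD(1)[OF A] selfadjoint_opD(1)[OF B]
    by (intro bounded_linear_add bounded_linear_const_scaleR)
  show "(a *\<^sub>R A x + b *\<^sub>R B x) \<bullet> y = x \<bullet> (a *\<^sub>R A y + b *\<^sub>R B y)" for x y
    using selfadjoint_opD(2)[OF A] selfadjoint_opD(2)[OF B] by (simp add: inner_add)
  show "a *\<^sub>R A (\<i> *\<^sub>C x) + b *\<^sub>R B (\<i> *\<^sub>C x) = \<i> *\<^sub>C (a *\<^sub>R A x + b *\<^sub>R B x)" for x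
    using selfadjoint_opD(3)[OF A] selfadjoint_opD(3)[OF B]
    by (simp add: scaleC_add_right scaleR_scaleC scaleC_scaleC mult.commute)
qed

lemma quad_combination: "quad (\<lambda>x. a *\<^sub>R A x + b *\<^sub>R B x) u = a * quad A u + b * quad B u"
  by (simp add: quad_inner inner_add_left)

lemma positive_op_iff: "positive_op A \<longleftrightarrow> selfadjoint_op A \<and> (\<forall>u. 0 \<le> quad A u)"
  by (simp add: positive_op_def loewner_le_def quad_inner)

lemma positive_op_psd:
  assumes "positive_op A"
  shows "psd A"
proof -
  from assms have A: "selfadjoint_op A" and "\<forall>u. 0 \<le> A u \<bullet> u"
    by (simp_all add: positive_op_iff quad_inner)
  with bounded_linear.linear[OF selfadjoint_opD(1)[OF A]] show ?thesis
    unfolding psd_def by (blast intro: selfadjoint_opD(2)[OF A])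
qed

lemma quad_i:
  assumes "selfadjoint_op A"
  shows "quad A (\<i> *\<^sub>C u) = quad A u"
  by (simp add: quad_inner selfadjoint_opD(3)[OF assms] inner_i)

lemma positive_op_scale:
  assumes "positive_op A" "0 \<le> r"
  shows "positive_op (\<lambda>x. r *\<^sub>R A x)" "quad (\<lambda>x. r *\<^sub>R A x) u = r * quad A u"
  using assms selfadjoint_op_combination[of A A r 0] quad_combination[of r A 0 A]
  by (simp_all add: positive_op_iff)

text \<open>
  Turns estimates of quadratic forms into norm estimates: Cauchy-Schwarz for \<open>D\<close> at \<open>u\<close> and \<open>D u\<close>.
\<close>

lemma psd_norm_bound:
  assumes D: "psd D" and le: "\<And>u. D u \<bullet> u \<le> M * (norm u)\<^sup>2"
  shows "(norm (D u))\<^sup>2 \<le> M * (D u \<bullet> u)"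
proof (cases "D u = 0")
  case False
  have "((norm (D u))\<^sup>2)\<^sup>2 \<le> (D u \<bullet> u) * (D (D u) \<bullet> D u)"
    using psd_Cauchy_Schwarz[OF D, of u "D u"] by (simp add: power2_norm_eq_inner)
  also have "\<dots> \<le> (D u \<bullet> u) * (M * (norm (D u))\<^sup>2)"
    by (intro mult_left_mono le psdD(3)[OF D])
  finally have "(norm (D u))\<^sup>2 * (norm (D u))\<^sup>2 \<le> (M * (D u \<bullet> u)) * (norm (D u))\<^sup>2"
    by (simp add: power2_eq_square mult_ac)
  then show ?thesis
    by (rule mult_right_le_imp_le) (use False in simp)
qed simp

lemma quad_bound:
  assumes "selfadjoint_op A"
  obtains M where "M \<ge> 0" "\<And>u. quad A u \<le> M * (norm u)\<^sup>2"
proof -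
  obtain M where M: "M \<ge> 0" "\<And>u. norm (A u) \<le> norm u * M"
    using bounded_linear.nonneg_bounded[OF selfadjoint_opD(1)[OF assms]] by blast
  have "quad A u \<le> M * (norm u)\<^sup>2" for u
  proof -
    have "quad A u \<le> norm (A u) * norm u" by (simp add: quad_inner norm_cauchy_schwarz)
    also have "\<dots> \<le> (norm u * M) * norm u" by (intro mult_right_mono M) simp
    finally show ?thesis by (simp add: power2_eq_square mult_ac)
  qed
  with M(1) that show ?thesis by blast
qed

text \<open>
  Boundedness is inherited from the upper bound \<open>A\<close>, and \<open>C\<close> commutes with \<open>\<i>\<close> by polarization,
  since its quadratic form is invariant under \<open>\<i>\<close>.
\<close>

lemma positive_opI:
  fixes C :: "'a::complex_hilbert_space \<Rightarrow> 'a"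
  assumes C: "psd C" and i: "\<And>u. quad C (\<i> *\<^sub>C u) \<le> quad C u"
    and A: "selfadjoint_op A" and le: "C \<sqsubseteq> A"
  shows "positive_op C"
proof -
  obtain M where M: "M \<ge> 0" "\<And>u. quad A u \<le> M * (norm u)\<^sup>2"
    using quad_bound[OF A] by blast
  have CM: "quad C u \<le> M * (norm u)\<^sup>2" for u
    using le M(2)[of u] order_trans by (auto simp: loewner_le_def)
  have "norm (C u) \<le> norm u * M" for u
  proof -
    have "(norm (C u))\<^sup>2 \<le> M * (C u \<bullet> u)"
      using psd_norm_bound[OF C] CM by (simp add: quad_inner)
    also have "\<dots> \<le> M * (M * (norm u)\<^sup>2)"
      using CM[of u] M(1) by (intro mult_left_mono) (auto simp: quad_inner)
    finally have "(norm (C u))\<^sup>2 \<le> (norm u * M)\<^sup>2"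
      by (simp add: power2_eq_square mult_ac)
    then show ?thesis
      by (rule power2_le_imp_le) (use M(1) in simp)
  qed
  then have bl: "bounded_linear C"
    using psdD(1)[OF C] by (intro bounded_linear_intro[where K = M]) (auto simp: linear_add linear_cmul)
  have qi: "quad C (\<i> *\<^sub>C u) = quad C u" for u
    \<comment> \<open>Two applications of the inequality lead from \<open>u\<close> to \<open>- u\<close>.\<close>
    using i[of u] i[of "\<i> *\<^sub>C u"] by (simp add: i_i quad_inner linear_neg[OF psdD(1)[OF C]])
  have ii: "C (\<i> *\<^sub>C u) \<bullet> (\<i> *\<^sub>C v) = C u \<bullet> v" for u v
    using qi[of "u + v"] qi[of u] qi[of v] psd_expand[OF C, of u v]
      psd_expand[OF C, of "\<i> *\<^sub>C u" "\<i> *\<^sub>C v"]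
    by (simp add: quad_inner scaleC_add_right)
  have "C (\<i> *\<^sub>C u) = \<i> *\<^sub>C C u" for u
  proof (rule vector_eq_ldot[THEN iffD1], rule allI)
    fix v :: 'a
    have v: "v = \<i> *\<^sub>C (- (\<i> *\<^sub>C v))"
      by (metis i_i add.inverse_inverse complex_vector.scale_minus_right)
    show "v \<bullet> C (\<i> *\<^sub>C u) = v \<bullet> (\<i> *\<^sub>C C u)"
      by (subst (1 2) v) (metis ii inner_i inner_commute)
  qed
  with bl psdD(2,3)[OF C] show ?thesis
    by (auto simp: positive_op_iff quad_inner intro: selfadjoint_opI)
qed

lemma quad_eq_imp_eq:
  assumes A: "positive_op A" and B: "positive_op B" and eq: "\<And>u. quad A u = quad B u"
  shows "A = B"
proof
  fix u
  have "A u \<bullet> v = B u \<bullet> v" for v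
    using eq[of "u + v"] eq[of u] eq[of v] psd_expand[OF positive_op_psd[OF A], of u v]
      psd_expand[OF positive_op_psd[OF B], of u v]
    by (simp add: quad_inner)
  then show "A u = B u" by (metis vector_eq_rdot)
qed

lemma finite_real_span:
  assumes "\<exists>B :: 'a::complex_hilbert_space set. finite B \<and> complex_vector.span B = UNIV"
  shows "\<exists>B :: 'a set. finite B \<and> span B = UNIV"
proof -
  obtain B :: "'a set" where B: "finite B" "complex_vector.span B = UNIV" using assms by blast
  define B' where "B' = B \<union> (*\<^sub>C) \<i> ` B"
  have i: "\<i> *\<^sub>C x \<in> span B'" if "x \<in> span B'" for x
    using that
  proof (induction rule: span_induct_alt)
    case base
    then show ?case by (simp add: span_zero)
  next
    case (step c x y)
    have "\<i> *\<^sub>C x \<in> span B'"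
    proof (cases "x \<in> B")
      case True
      then have "\<i> *\<^sub>C x \<in> B'" by (simp add: B'_def)
      then show ?thesis by (rule span_base)
    next
      case False
      with step(1) obtain b where b: "b \<in> B" "x = \<i> *\<^sub>C b" by (auto simp: B'_def)
      then have "b \<in> span B'" by (simp add: B'_def span_base)
      then show ?thesis unfolding b(2) i_i by (rule span_neg)
    qed
    moreover have "\<i> *\<^sub>C (c *\<^sub>R x + y) = c *\<^sub>R \<i> *\<^sub>C x + \<i> *\<^sub>C y"
      by (simp add: scaleC_add_right scaleR_scaleC scaleC_scaleC mult.commute)
    ultimately show ?case using step(2) by (simp add: span_add span_scale)
  qed
  have "x \<in> span B'" for x
  proof -
    have "x \<in> complex_vector.span B" using B(2) by simp
    then show ?thesis
    proof (induction rule: complex_vector.span_induct_alt)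
      case base
      then show ?case by (simp add: span_zero)
    next
      case (step c x y)
      then have "x \<in> span B'" by (auto simp: B'_def intro: span_base)
      then have "c *\<^sub>C x \<in> span B'"
        by (subst scaleC_Re_Im) (intro span_add span_scale i)
      with step(2) show ?case by (simp add: span_add)
    qed
  qed
  with B(1) show ?thesis by (intro exI[of _ B']) (auto simp: B'_def)
qed

section \<open>Parallel sums and shorted operators in finite dimension\<close>

text \<open>
  The infimum is the partial minimum of the form of \<open>(p, q) \<mapsto> (A p, B q)\<close> over the coset of \<open>(0, u)\<close>
  modulo the antidiagonal, whose elements are the pairs \<open>(v, u - v)\<close>.
\<close>

lemma
  fixes A B :: "'a::complex_hilbert_space \<Rightarrow> 'a"
  assumes fin: "\<exists>E :: 'a set. finite E \<and> span E = UNIV"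
    and A: "positive_op A" and B: "positive_op B"
  shows parallel_sum_positive: "positive_op (A \<parallel> B)"
    and parallel_sum_quad: "quad (A \<parallel> B) u = (INF v. quad A v + quad B (u - v))"
proof -
  note pA = positive_op_psd[OF A] and pB = positive_op_psd[OF B]
  obtain E :: "'a set" where E: "finite E" "span E = UNIV" using fin by blast
  define D where "D = (\<lambda>p. (A (fst p), B (snd p)))"
  have D: "psd D"
    unfolding psd_def D_def
    using psdD(2,3)[OF pA] psdD(2,3)[OF pB]
    by (auto intro!: linearI simp: psdD(4,6)[OF pA] psdD(4,6)[OF pB] inner_prod_def)
  define E' where "E' = (\<lambda>v. (v, - v)) ` E"
  have "span E' = (\<lambda>v. (v, - v)) ` span E"
    unfolding E'_def by (rule linear_span_image) (auto intro!: linearI)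
  then have E': "span E' = range (\<lambda>v. (v, - v))" using E by simp
  obtain C where C: "psd C"
    "\<And>u. \<exists>y\<in>span E'. C u \<bullet> u = D ((0, u) + y) \<bullet> ((0, u) + y)"
    "\<And>u y. y \<in> span E' \<Longrightarrow> C u \<bullet> u \<le> D ((0, u) + y) \<bullet> ((0, u) + y)"
    by (rule psd_partial_minimum[OF D, of E' snd "\<lambda>u. (0, u)"])
      (use E(1) in \<open>auto simp: inner_prod_def E'_def\<close>)
  have attained: "\<exists>v. quad C u = quad A v + quad B (u - v)" for u
    using C(2)[of u] by (auto simp: E' quad_inner inner_prod_def D_def)
  have le: "quad C u \<le> quad A v + quad B (u - v)" for u v
    using C(3)[of "(v, - v)" u] by (auto simp: E' quad_inner inner_prod_def D_def)
  have "positive_op C"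
  proof (rule positive_opI[OF C(1)])
    fix u
    obtain v where v: "quad C u = quad A v + quad B (u - v)" using attained by blast
    have "quad C (\<i> *\<^sub>C u) \<le> quad A (\<i> *\<^sub>C v) + quad B (\<i> *\<^sub>C u - \<i> *\<^sub>C v)" by (rule le)
    also have "\<dots> = quad C u"
      using A B v by (simp add: positive_op_iff quad_i flip: complex_vector.scale_right_diff_distrib)
    finally show "quad C (\<i> *\<^sub>C u) \<le> quad C u" .
  next
    show "selfadjoint_op A" using A by (simp add: positive_op_iff)
    show "C \<sqsubseteq> A"
      unfolding loewner_le_def
      using le[of u u for u] by (simp add: quad_inner psdD(7)[OF pB])
  qed
  moreover have "quad C u = (INF v. quad A v + quad B (u - v))" for u
  proof -
    obtain v where "quad C u = quad A v + quad B (u - v)" using attained by blast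
    then have "quad C u \<in> range (\<lambda>v. quad A v + quad B (u - v))" by blast
    then show ?thesis
      by (intro cInf_eq_minimum[symmetric]) (use le in auto)
  qed
  ultimately have ex: "positive_op C \<and> (\<forall>u. quad C u = (INF v. quad A v + quad B (u - v)))"
    by blast
  have "positive_op (A \<parallel> B) \<and> (\<forall>u. quad (A \<parallel> B) u = (INF v. quad A v + quad B (u - v)))"
    unfolding parallel_sum_def
  proof (rule theI[where a = C])
    show "positive_op C \<and> (\<forall>u. quad C u = (INF v. quad A v + quad B (u - v)))" by (rule ex)
  next
    fix C' assume "positive_op C' \<and> (\<forall>u. quad C' u = (INF v. quad A v + quad B (u - v)))"
    with ex show "C' = C" by (intro quad_eq_imp_eq) simp_all
  qed
  then show "positive_op (A \<parallel> B)" "quad (A \<parallel> B) u = (INF v. quad A v + quad B (u - v))"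
    by auto
qed

context
  fixes A B :: "'a::complex_hilbert_space \<Rightarrow> 'a"
  assumes fin: "\<exists>E :: 'a set. finite E \<and> span E = UNIV"
    and A: "positive_op A" and B: "positive_op B"
begin

lemma parallel_sum_le: "quad (A \<parallel> B) u \<le> quad A v + quad B (u - v)"
  unfolding parallel_sum_quad[OF fin A B]
  using A B by (intro cINF_lower bdd_belowI2[where m = 0]) (auto simp: positive_op_iff)

lemma parallel_sum_greatest:
  "(\<And>v. c \<le> quad A v + quad B (u - v)) \<Longrightarrow> c \<le> quad (A \<parallel> B) u"
  unfolding parallel_sum_quad[OF fin A B] by (intro cINF_greatest) auto

lemma parallel_sum_le_left: "quad (A \<parallel> B) u \<le> quad A u"
  using parallel_sum_le[of u u] positive_op_psd[OF B] by (simp add: quad_inner psdD(7))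

lemma parallel_sum_le_right: "quad (A \<parallel> B) u \<le> quad B u"
  using parallel_sum_le[of u 0] positive_op_psd[OF A] by (simp add: quad_inner psdD(7))

text \<open>
  The left-hand side is the form of \<open>(a L) : L\<close>, so this is monotonicity of the parallel sum. The
  inequality behind it is \<open>quad L (u - (1 + a) v) \<ge> 0\<close>.
\<close>

lemma parallel_sum_scaled_lower_bound:
  assumes L: "positive_op L" and a: "0 < a"
    and LA: "\<And>v. a * quad L v \<le> quad A v" and LB: "L \<sqsubseteq> B"
  shows "a / (1 + a) * quad L u \<le> quad (A \<parallel> B) u"
proof (rule parallel_sum_greatest)
  fix v
  note pL = positive_op_psd[OF L]
  have "0 \<le> quad L (u + (- (1 + a)) *\<^sub>R v)"
    using L by (simp add: positive_op_iff)
  then have "0 \<le> quad L u - 2 * (1 + a) * (L u \<bullet> v) + (1 + a)\<^sup>2 * quad L v"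
    unfolding quad_inner psd_expand_scaled[OF pL] by (simp add: algebra_simps power2_eq_square)
  moreover have eq: "quad L (u - v) = quad L u - 2 * (L u \<bullet> v) + quad L v"
    using psd_expand_scaled[OF pL, of u "-1" v] by (simp add: quad_inner)
  ultimately have "a * quad L u \<le> (1 + a) * (a * quad L v + quad L (u - v))"
    unfolding eq by (simp add: power2_eq_square algebra_simps)
  then have "a / (1 + a) * quad L u \<le> a * quad L v + quad L (u - v)"
    using a by (simp add: field_simps)
  also have "\<dots> \<le> quad A v + quad B (u - v)"
    using LA LB by (auto simp: loewner_le_def intro: add_mono)
  finally show "a / (1 + a) * quad L u \<le> quad A v + quad B (u - v)" .
qed

end

text \<open>
  The last part says that the parallel sum of \<open>k\<close> operators above \<open>L\<close> is above \<open>L / k\<close>, the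
  parallel sum of \<open>k\<close> copies of \<open>L\<close>.
\<close>

lemma parallel_sum_upto_properties:
  fixes A :: "nat \<Rightarrow> 'a::complex_hilbert_space \<Rightarrow> 'a"
  assumes fin: "\<exists>E :: 'a set. finite E \<and> span E = UNIV"
    and "1 \<le> k" and "\<And>j. j \<in> {1..k} \<Longrightarrow> positive_op (A j)"
  shows "positive_op (parallel_sum_upto k A) \<and> (\<forall>j\<in>{1..k}. parallel_sum_upto k A \<sqsubseteq> A j) \<and>
    (\<forall>L. positive_op L \<and> (\<forall>j\<in>{1..k}. L \<sqsubseteq> A j) \<longrightarrow>
       (\<forall>u. quad L u \<le> k * quad (parallel_sum_upto k A) u))"
  using assms(2,3)
proof (induction k rule: dec_induct)
  case base
  then show ?case by (simp add: parallel_sum_upto_def loewner_le_def)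
next
  case (step k)
  let ?S = "parallel_sum_upto k A"
  from step have IH: "positive_op ?S" "\<forall>j\<in>{1..k}. ?S \<sqsubseteq> A j"
    "\<forall>L. positive_op L \<and> (\<forall>j\<in>{1..k}. L \<sqsubseteq> A j) \<longrightarrow> (\<forall>u. quad L u \<le> k * quad ?S u)"
    and Ak: "positive_op (A (Suc k))" by auto
  have S: "parallel_sum_upto (Suc k) A = ?S \<parallel> A (Suc k)"
    using step(1) by (simp add: parallel_sum_upto_def)
  note le = parallel_sum_le_left[OF fin IH(1) Ak] parallel_sum_le_right[OF fin IH(1) Ak]
  have "?S \<parallel> A (Suc k) \<sqsubseteq> A j" if "j \<in> {1..Suc k}" for j
  proof (cases "j = Suc k")
    case True
    then show ?thesis using le(2) by (simp add: loewner_le_def)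
  next
    case False
    then have "?S \<sqsubseteq> A j" using IH(2) that by auto
    then show ?thesis using le(1) order_trans unfolding loewner_le_def by blast
  qed
  moreover have "quad L u \<le> Suc k * quad (?S \<parallel> A (Suc k)) u"
    if L: "positive_op L" "\<forall>j\<in>{1..Suc k}. L \<sqsubseteq> A j" for L u
  proof -
    have "quad L v \<le> k * quad ?S v" for v using IH(3) L by auto
    then have "1 / k * quad L v \<le> quad ?S v" for v
      using step(1) by (simp add: field_simps)
    from parallel_sum_scaled_lower_bound[OF fin IH(1) Ak L(1) _ this, of u]
    have "(1 / k) / (1 + 1 / k) * quad L u \<le> quad (?S \<parallel> A (Suc k)) u"
      using step(1) L(2) by auto
    moreover have "(1 / k) / (1 + 1 / k) = 1 / Suc k"
      using step(1) by (simp add: field_simps)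
    ultimately show ?thesis by (simp add: field_simps)
  qed
  ultimately show ?case
    using parallel_sum_positive[OF fin IH(1) Ak] unfolding S by blast
qed

text \<open>
  The quadratic forms converge as bounded monotone real sequences. By Cauchy-Schwarz the squared
  norms \<open>(norm (X m' u - X m u))\<^sup>2\<close> are controlled by the differences of the forms, so \<open>X m u\<close> is a
  Cauchy sequence.
\<close>

lemma monotone_bounded_limit:
  assumes X: "\<And>m. positive_op (X m)" and mono: "\<And>m m' u. m \<le> m' \<Longrightarrow> quad (X m) u \<le> quad (X m') u"
    and B: "selfadjoint_op B" and le: "\<And>m. X m \<sqsubseteq> B"
  shows "positive_op (\<lambda>u. lim (\<lambda>m::nat. X m u))" (is "positive_op ?T")
    and "(\<lambda>m. quad (X m) u) \<longlonglongrightarrow> quad (\<lambda>u. lim (\<lambda>m. X m u)) u"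
proof -
  obtain M where M: "M \<ge> 0" "\<And>u. quad B u \<le> M * (norm u)\<^sup>2"
    using quad_bound[OF B] by blast
  note pX = positive_op_psd[OF X]
  have diff: "(norm (X m' u - X m u))\<^sup>2 \<le> M * (quad (X m') u - quad (X m) u)" if "m \<le> m'" for m m' u
  proof -
    have "psd (\<lambda>u. X m' u - X m u)"
      using psdD(2)[OF pX] mono[OF that]
      by (auto intro!: linear_compose_sub psdD(1)[OF pX] simp: psd_def inner_diff quad_inner)
    moreover have "(X m' u - X m u) \<bullet> u \<le> M * (norm u)\<^sup>2" for u
    proof -
      have "0 \<le> quad (X m) u" "quad (X m') u \<le> quad B u"
        using X le by (auto simp: positive_op_iff loewner_le_def)
      with M(2)[of u] show ?thesis by (simp add: quad_inner inner_diff_left)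
    qed
    ultimately show ?thesis
      using psd_norm_bound[of "\<lambda>u. X m' u - X m u" M u] by (simp add: quad_inner inner_diff_left)
  qed
  have lim: "(\<lambda>m. X m u) \<longlonglongrightarrow> ?T u" for u
  proof -
    have "convergent (\<lambda>m. quad (X m) u)"
    proof (rule Bseq_mono_convergent)
      show "Bseq (\<lambda>m. quad (X m) u)"
        using X le by (intro BseqI'[where K = "quad B u"]) (auto simp: positive_op_iff loewner_le_def)
    qed (use mono in auto)
    then have cau: "Cauchy (\<lambda>m. quad (X m) u)" by (rule convergent_Cauchy)
    have "Cauchy (\<lambda>m. X m u)"
    proof (rule CauchyI')
      fix e :: real assume e: "e > 0"
      then have "e\<^sup>2 / (M + 1) > 0" using M(1) by simp
      then obtain N where N: "\<And>m m'. m \<ge> N \<Longrightarrow> m' \<ge> N \<Longrightarrow>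
          norm (quad (X m) u - quad (X m') u) < e\<^sup>2 / (M + 1)"
        using CauchyD[OF cau] by metis
      have "dist (X m u) (X m' u) < e" if "m \<ge> N" "m < m'" for m m'
      proof -
        have "(norm (X m' u - X m u))\<^sup>2 \<le> M * (quad (X m') u - quad (X m) u)"
          using diff that by simp
        also have "\<dots> \<le> (M + 1) * norm (quad (X m') u - quad (X m) u)"
          using M(1) mono[of m m' u] that by (intro mult_mono) auto
        also have "\<dots> < e\<^sup>2"
          using N[of m' m] that M(1) by (simp add: field_simps)
        finally show ?thesis
          using e by (simp add: dist_norm norm_minus_commute power_less_imp_less_base)
      qed
      then show "\<exists>N. \<forall>m\<ge>N. \<forall>m'>m. dist (X m u) (X m' u) < e" by blast
    qed
    then show ?thesis by (simp add: Cauchy_convergent_iff convergent_LIMSEQ_iff)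
  qed
  have qlim: "(\<lambda>m. quad (X m) u) \<longlonglongrightarrow> quad ?T u" for u
    unfolding quad_inner by (intro tendsto_inner lim tendsto_const)
  have "psd ?T"
    unfolding psd_def
  proof (intro conjI allI linearI)
    show "?T (x + y) = ?T x + ?T y" for x y
      using lim[of "x + y"] tendsto_add[OF lim[of x] lim[of y]]
      unfolding psdD(4)[OF pX] by (rule LIMSEQ_unique)
    show "?T (r *\<^sub>R x) = r *\<^sub>R ?T x" for r x
      using lim[of "r *\<^sub>R x"] tendsto_scaleR[OF tendsto_const lim[of x], of r]
      unfolding psdD(6)[OF pX] by (rule LIMSEQ_unique)
    show "?T x \<bullet> y = x \<bullet> ?T y" for x y
    proof (rule LIMSEQ_unique)
      show "(\<lambda>m. X m x \<bullet> y) \<longlonglongrightarrow> ?T x \<bullet> y"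
        by (intro tendsto_inner lim tendsto_const)
      show "(\<lambda>m. X m x \<bullet> y) \<longlonglongrightarrow> x \<bullet> ?T y"
        unfolding psdD(2)[OF pX] by (intro tendsto_inner lim tendsto_const)
    qed
    show "0 \<le> ?T x \<bullet> x" for x
    proof -
      have "0 \<le> quad ?T x"
        by (rule tendsto_lowerbound[OF qlim]) (use X in \<open>auto simp: positive_op_iff\<close>)
      then show ?thesis by (simp only: quad_inner)
    qed
  qed
  then show "positive_op ?T"
  proof (rule positive_opI[OF _ _ B])
    have "quad (X m) (\<i> *\<^sub>C u) = quad (X m) u" for m u
      using X by (simp add: quad_i positive_op_iff)
    then show "quad ?T (\<i> *\<^sub>C u) \<le> quad ?T u" for u
      using LIMSEQ_unique[OF qlim[of "\<i> *\<^sub>C u"], of "quad ?T u"] qlim[of u] by simp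
    show "?T \<sqsubseteq> B"
      unfolding loewner_le_def
      using le by (intro allI tendsto_upperbound[OF qlim]) (auto simp: loewner_le_def)
  qed
  show "(\<lambda>m. quad (X m) u) \<longlonglongrightarrow> quad (\<lambda>u. lim (\<lambda>m. X m u)) u" by (rule qlim)
qed

context
  fixes S B :: "'a::complex_hilbert_space \<Rightarrow> 'a"
  assumes fin: "\<exists>E :: 'a set. finite E \<and> span E = UNIV"
    and S: "positive_op S" and B: "positive_op B"
begin

lemma
  shows parallel_limit_positive: "positive_op (parallel_limit S B)"
    and parallel_limit_quad:
      "(\<lambda>m. quad ((\<lambda>x. real m *\<^sub>R S x) \<parallel> B) u) \<longlonglongrightarrow> quad (parallel_limit S B) u"
proof -
  define X where "X = (\<lambda>m. (\<lambda>x. real m *\<^sub>R S x) \<parallel> B)"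
  note mS = positive_op_scale[OF S of_nat_0_le_iff]
  have X: "positive_op (X m)" for m
    unfolding X_def by (rule parallel_sum_positive[OF fin mS(1) B])
  have mono: "quad (X m) u \<le> quad (X m') u" if "m \<le> m'" for m m' u
    unfolding X_def
  proof (rule parallel_sum_greatest[OF fin mS(1) B])
    fix v
    have "quad ((\<lambda>x. real m *\<^sub>R S x) \<parallel> B) u \<le> m * quad S v + quad B (u - v)"
      using parallel_sum_le[OF fin mS(1) B] by (simp add: mS(2))
    also have "\<dots> \<le> m' * quad S v + quad B (u - v)"
      using that S by (intro add_mono mult_right_mono) (auto simp: positive_op_iff)
    finally show "quad ((\<lambda>x. real m *\<^sub>R S x) \<parallel> B) u
        \<le> quad (\<lambda>x. real m' *\<^sub>R S x) v + quad B (u - v)"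
      by (simp add: mS(2))
  qed
  have le: "X m \<sqsubseteq> B" for m
    unfolding X_def loewner_le_def using parallel_sum_le_right[OF fin mS(1) B] by blast
  have sB: "selfadjoint_op B" using B by (simp add: positive_op_iff)
  show "positive_op (parallel_limit S B)"
    using monotone_bounded_limit(1)[of X, OF X mono sB le] by (simp add: parallel_limit_def X_def)
  show "(\<lambda>m. quad ((\<lambda>x. real m *\<^sub>R S x) \<parallel> B) u) \<longlonglongrightarrow> quad (parallel_limit S B) u"
    using monotone_bounded_limit(2)[of X, OF X mono sB le] by (simp add: parallel_limit_def X_def)
qed

lemma parallel_limit_le: "parallel_limit S B \<sqsubseteq> B"
  unfolding loewner_le_def
  using parallel_sum_le_right[OF fin positive_op_scale(1)[OF S of_nat_0_le_iff] B]
  by (intro allI tendsto_upperbound[OF parallel_limit_quad]) auto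

lemma parallel_limit_null:
  assumes "quad S u = 0"
  shows "quad (parallel_limit S B) u = 0"
proof -
  have "quad ((\<lambda>x. real m *\<^sub>R S x) \<parallel> B) u \<le> 0" for m
    using parallel_sum_le_left[OF fin positive_op_scale(1)[OF S of_nat_0_le_iff] B, of m u] assms
    by (simp add: positive_op_scale(2)[OF S])
  then have "quad (parallel_limit S B) u \<le> 0"
    by (intro tendsto_upperbound[OF parallel_limit_quad]) auto
  with parallel_limit_positive show ?thesis by (simp add: positive_op_iff order_antisym)
qed

text \<open>
  From \<open>(m / K) L \<le> m S\<close> it follows that \<open>(m S) : B\<close> is above \<open>((m / K) L) : L\<close>, which is the
  multiple of \<open>L\<close> by \<open>(m / K) / (1 + m / K)\<close>; this factor tends to \<open>1\<close>.
\<close>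

lemma parallel_limit_greatest:
  assumes L: "positive_op L" and LB: "L \<sqsubseteq> B" and K: "0 < K" and LS: "\<And>u. quad L u \<le> K * quad S u"
  shows "L \<sqsubseteq> parallel_limit S B"
  unfolding loewner_le_def
proof
  fix u
  have "(\<lambda>m. (m / K) / (1 + m / K) * quad L u) \<longlonglongrightarrow> 1 * quad L u"
  proof (rule tendsto_mult_right)
    have "(\<lambda>m. 1 - K * inverse (K + real m)) \<longlonglongrightarrow> 1 - K * 0"
      by (intro tendsto_intros tendsto_inverse_0_at_top
          filterlim_tendsto_add_at_top[OF tendsto_const filterlim_real_sequentially])
    moreover have "1 - K * inverse (K + real m) = (m / K) / (1 + m / K)" for m
      using K by (simp add: field_simps add_pos_nonneg)
    ultimately show "(\<lambda>m. (m / K) / (1 + m / K)) \<longlonglongrightarrow> 1" by simp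
  qed
  moreover have "(m / K) / (1 + m / K) * quad L u \<le> quad ((\<lambda>x. real m *\<^sub>R S x) \<parallel> B) u"
    if "m \<ge> 1" for m :: nat
  proof (rule parallel_sum_scaled_lower_bound[OF fin positive_op_scale(1)[OF S] B L _ _ LB])
    fix v
    show "m / K * quad L v \<le> quad (\<lambda>x. real m *\<^sub>R S x) v"
      using mult_left_mono[OF LS[of v], of "real m"] K
      by (simp add: positive_op_scale(2)[OF S] field_simps)
  qed (use K that in auto)
  ultimately show "quad L u \<le> quad (parallel_limit S B) u"
    using tendsto_le[OF sequentially_bot parallel_limit_quad, of _ "1 * quad L u" u]
    by (auto simp: eventually_at_top_linorder)
qed

end

text \<open>
  The operator \<open>C\<close> is the shorted operator of \<open>D\<close> to the range of \<open>S\<close>: its form at \<open>u\<close> is the minimum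
  of the form of \<open>D\<close> over \<open>u + ker S\<close>. The last conclusion expresses that it is the greatest lower
  bound of those values.
\<close>

lemma shorted_operator:
  fixes S D :: "'a::complex_hilbert_space \<Rightarrow> 'a"
  assumes fin: "\<exists>E :: 'a set. finite E \<and> span E = UNIV"
    and S: "positive_op S" and D: "positive_op D"
  obtains C where "positive_op C" "C \<sqsubseteq> D" "\<And>y. quad S y = 0 \<Longrightarrow> quad C y = 0"
    "\<And>u c. (\<And>y. quad S y = 0 \<Longrightarrow> c \<le> quad D (u + y)) \<Longrightarrow> c \<le> quad C u"
proof -
  note pS = positive_op_psd[OF S] and pD = positive_op_psd[OF D]
  define V where "V = {y. quad S y = 0}"
  have V_eq: "V = {y. S y = 0}"
    using psd_null[OF pS] by (auto simp: V_def quad_inner)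
  obtain E :: "'a set" where E: "finite E" "span E = UNIV" using fin by blast
  obtain F where F: "F \<subseteq> V" "independent F" "V \<subseteq> span F"
    by (metis real_vector.maximal_independent_subset)
  have "finite F" using real_vector.independent_span_bound[OF E(1) F(2)] E(2) by auto
  have "subspace V"
    unfolding V_eq by (auto simp: subspace_def psdD[OF pS])
  with F have V: "span F = V" by (metis span_minimal subset_antisym)
  obtain C where C: "psd C"
    "\<And>u. \<exists>y\<in>V. quad C u = quad D (u + y)"
    "\<And>u y. y \<in> V \<Longrightarrow> quad C u \<le> quad D (u + y)"
    using psd_partial_minimum[OF pD \<open>finite F\<close>, of id id] by (auto simp: V quad_inner)
  have sS: "selfadjoint_op S" and sD: "selfadjoint_op D" using S D by (auto simp: positive_op_iff)
  have 0: "0 \<in> V" by (simp add: V_eq psdD(7)[OF pS])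
  have le: "C \<sqsubseteq> D" using C(3)[OF 0] by (simp add: loewner_le_def)
  have "positive_op C"
  proof (rule positive_opI[OF C(1) _ sD le])
    fix u
    obtain y where y: "y \<in> V" "quad C u = quad D (u + y)" using C(2) by blast
    then have "\<i> *\<^sub>C y \<in> V" by (simp add: V_def quad_i[OF sS])
    from C(3)[OF this, of "\<i> *\<^sub>C u"] y(2) show "quad C (\<i> *\<^sub>C u) \<le> quad C u"
      by (simp add: quad_i[OF sD] flip: scaleC_add_right)
  qed
  moreover have "quad C y = 0" if "quad S y = 0" for y
  proof -
    have "- y \<in> V" using that subspace_neg[OF \<open>subspace V\<close>, of y] unfolding V_def by blast
    from C(3)[OF this, of y] have "quad C y \<le> 0" by (simp add: quad_inner)
    with psdD(3)[OF C(1), of y] show ?thesis by (simp add: quad_inner)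
  qed
  moreover have "c \<le> quad C u" if "\<And>y. quad S y = 0 \<Longrightarrow> c \<le> quad D (u + y)" for u c
    using C(2)[of u] that by (auto simp: V_def)
  ultimately show ?thesis using that le by blast
qed

section \<open>Greatest positive lower bounds and infima\<close>

text \<open>
  Given a self-adjoint lower bound \<open>L\<close>, shorting \<open>D = T k - L\<close> yields \<open>C\<close>, and \<open>L' = T k - C\<close> is a
  lower bound above \<open>L\<close> that vanishes on \<open>ker S\<close>. As \<open>L' \<ge> - K S\<close> and \<open>G \<ge> S\<close>, moving from \<open>G\<close> a
  little towards \<open>L'\<close> stays within the positive lower bounds, where \<open>G\<close> is greatest.
\<close>

lemma greatest_positive_imp_infimum:
  fixes T :: "nat \<Rightarrow> 'a::complex_hilbert_space \<Rightarrow> 'a"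
  assumes fin: "\<exists>E :: 'a set. finite E \<and> span E = UNIV"
    and "k \<in> I" and T: "\<And>j. j \<in> I \<Longrightarrow> positive_op (T j)"
    and S: "positive_op S" "\<And>j. j \<in> I \<Longrightarrow> S \<sqsubseteq> T j"
    and null: "\<And>j u. j \<in> I \<Longrightarrow> quad S u = 0 \<Longrightarrow> quad (T j) u = 0"
    and G: "is_greatest_element G (positive_lower_bounds (T ` I))"
  shows "is_infimum G (T ` I)"
proof -
  have G': "positive_op G" "\<And>j. j \<in> I \<Longrightarrow> G \<sqsubseteq> T j"
    "\<And>H. positive_op H \<Longrightarrow> (\<And>j. j \<in> I \<Longrightarrow> H \<sqsubseteq> T j) \<Longrightarrow> H \<sqsubseteq> G"
    using G by (auto simp: is_greatest_element_def positive_lower_bounds_def)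
  have "L \<sqsubseteq> G" if L: "selfadjoint_op L" "\<And>j. j \<in> I \<Longrightarrow> L \<sqsubseteq> T j" for L
  proof -
    define D where "D = (\<lambda>x. 1 *\<^sub>R T k x + (-1) *\<^sub>R L x)"
    have qD: "quad D u = quad (T k) u - quad L u" for u
      unfolding D_def quad_combination by simp
    have sT: "selfadjoint_op (T k)" using T \<open>k \<in> I\<close> by (simp add: positive_op_iff)
    have "selfadjoint_op D" unfolding D_def by (rule selfadjoint_op_combination[OF sT L(1)])
    then have D: "positive_op D"
      using L(2)[OF \<open>k \<in> I\<close>] by (simp add: positive_op_iff qD loewner_le_def)
    obtain C where C: "positive_op C" "C \<sqsubseteq> D" "\<And>y. quad S y = 0 \<Longrightarrow> quad C y = 0"
      "\<And>u c. (\<And>y. quad S y = 0 \<Longrightarrow> c \<le> quad D (u + y)) \<Longrightarrow> c \<le> quad C u"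
      using shorted_operator[OF fin S(1) D] by blast
    have T_shift: "quad (T j) (u + y) = quad (T j) u" if "j \<in> I" "quad S y = 0" for j u y
      using psd_add_null[OF positive_op_psd[OF T]] null that by (simp add: quad_inner)
    \<comment> \<open>This says \<open>L' \<le> T j\<close>: on \<open>u + ker S\<close> the form of \<open>D\<close> is at least that of \<open>T k - T j\<close>,
      which is constant there.\<close>
    have CT: "quad (T k) u - quad C u \<le> quad (T j) u" if j: "j \<in> I" for j u
    proof -
      have "quad (T k) u - quad (T j) u \<le> quad D (u + y)" if y: "quad S y = 0" for y
      proof -
        have "quad L (u + y) \<le> quad (T j) (u + y)"
          using L(2)[OF j] by (simp add: loewner_le_def)
        then show ?thesis
          using T_shift[OF j y, of u] T_shift[OF \<open>k \<in> I\<close> y, of u] by (simp add: qD)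
      qed
      then show ?thesis using C(4)[of "quad (T k) u - quad (T j) u" u] by simp
    qed
    obtain E :: "'a set" where E: "finite E" "span E = UNIV" using fin by blast
    obtain K where K: "K \<ge> 0" "\<And>u. quad C u \<le> K * quad S u"
      using psd_dominated[OF positive_op_psd[OF S(1)] positive_op_psd[OF C(1)] _ E(1)] C(3) E(2)
      by (auto simp: quad_inner)
    \<comment> \<open>Chosen so that \<open>(1 - t) S - t K S = 0\<close>.\<close>
    define t where "t = 1 / (1 + K)"
    have t: "0 < t" "t \<le> 1" "t * (1 + K) = 1" using K(1) by (auto simp: t_def)
    define L' where "L' = (\<lambda>x. 1 *\<^sub>R T k x + (-1) *\<^sub>R C x)"
    define H where "H = (\<lambda>x. (1 - t) *\<^sub>R G x + t *\<^sub>R L' x)"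
    have qL': "quad L' u = quad (T k) u - quad C u" for u
      unfolding L'_def quad_combination by simp
    have qH: "quad H u = (1 - t) * quad G u + t * quad L' u" for u
      unfolding H_def quad_combination ..
    have "selfadjoint_op H"
      unfolding H_def L'_def using G'(1) sT C(1)
      by (intro selfadjoint_op_combination) (auto simp: positive_op_iff)
    moreover have "0 \<le> quad H u" for u
    proof -
      have "quad S u \<le> quad G u" using G'(3)[OF S] by (simp add: loewner_le_def)
      moreover have L'_ge: "- (K * quad S u) \<le> quad L' u"
      proof -
        have "0 \<le> quad (T k) u" using T[OF \<open>k \<in> I\<close>] by (simp add: positive_op_iff)
        with K(2)[of u] show ?thesis by (simp add: qL')
      qed
      ultimately have "(1 - t) * quad S u + t * (- (K * quad S u)) \<le> (1 - t) * quad G u + t * quad L' u"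
        using t L'_ge by (intro add_mono mult_left_mono) auto
      moreover have "(1 - t) * quad S u + t * (- (K * quad S u)) = (1 - t * (1 + K)) * quad S u"
        by (simp add: algebra_simps)
      then have "(1 - t) * quad S u + t * (- (K * quad S u)) = 0" by (simp add: t(3))
      ultimately show ?thesis unfolding qH by linarith
    qed
    ultimately have "positive_op H" by (simp add: positive_op_iff)
    moreover have "H \<sqsubseteq> T j" if j: "j \<in> I" for j
      unfolding loewner_le_def
    proof
      fix u
      have "quad H u \<le> (1 - t) * quad (T j) u + t * quad (T j) u"
        unfolding qH using t G'(2)[OF j] CT[OF j, of u]
        by (intro add_mono mult_left_mono) (auto simp: qL' loewner_le_def)
      then show "quad H u \<le> quad (T j) u" by (simp add: algebra_simps)
    qed
    ultimately have HG: "H \<sqsubseteq> G" by (rule G'(3))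
    show "L \<sqsubseteq> G"
      unfolding loewner_le_def
    proof
      fix u
      have "quad H u \<le> quad G u" using HG by (simp add: loewner_le_def)
      then have "t * quad L' u \<le> t * quad G u" by (simp add: qH algebra_simps)
      then have "quad L' u \<le> quad G u" using t(1) by simp
      moreover have "quad C u \<le> quad D u" using C(2) by (simp add: loewner_le_def)
      ultimately show "quad L u \<le> quad G u" by (simp add: qL' qD)
    qed
  qed
  with G' show ?thesis
    by (auto simp: is_infimum_def is_greatest_element_def lower_bounds_def positive_op_iff)
qed

lemma infimum_imp_greatest_positive:
  fixes G :: "'a::complex_hilbert_space \<Rightarrow> 'a"
  assumes "is_infimum G \<A>" and "\<And>A. A \<in> \<A> \<Longrightarrow> positive_op A"
  shows "is_greatest_element G (positive_lower_bounds \<A>)"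
proof -
  have "selfadjoint_op (\<lambda>_::'a. 0::'a)"
    by (rule selfadjoint_opI) auto
  then have "(\<lambda>_. 0) \<in> lower_bounds \<A>"
    using assms(2) by (auto simp: lower_bounds_def positive_op_def)
  with assms(1) show ?thesis
    by (auto simp: is_infimum_def is_greatest_element_def lower_bounds_def
        positive_lower_bounds_def positive_op_def)
qed

theorem theorem6p15:
  fixes A :: "nat \<Rightarrow> 'a::complex_hilbert_space \<Rightarrow> 'a" and n :: nat and S :: "'a \<Rightarrow> 'a"
  assumes finite_dim: "\<exists>B :: 'a set. finite B \<and> complex_vector.span B = UNIV"
    and n_pos: "1 \<le> n"
    and pos: "\<And>j. j \<in> {1..n} \<Longrightarrow> positive_op (A j)"
    and S_def: "S = parallel_sum_upto n A"
  shows "(\<exists>G. is_greatest_element G (positive_lower_bounds (A ` {1..n}))) \<longleftrightarrow>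
         (\<exists>G. is_infimum G ((\<lambda>j. parallel_limit S (A j)) ` {1..n}))"
proof -
  note fin = finite_real_span[OF finite_dim]
  have S: "positive_op S" "\<And>j. j \<in> {1..n} \<Longrightarrow> S \<sqsubseteq> A j"
    "\<And>L u. positive_op L \<Longrightarrow> \<forall>j\<in>{1..n}. L \<sqsubseteq> A j \<Longrightarrow> quad L u \<le> n * quad S u"
    using parallel_sum_upto_properties[OF fin n_pos, of A] pos unfolding S_def by blast+
  define T where "T = (\<lambda>j. parallel_limit S (A j))"
  have T: "positive_op (T j)" "T j \<sqsubseteq> A j" if "j \<in> {1..n}" for j
    using parallel_limit_positive[OF fin S(1) pos] parallel_limit_le[OF fin S(1) pos] that
    by (auto simp: T_def)
  have LT: "L \<sqsubseteq> T j" if "positive_op L" "\<forall>j\<in>{1..n}. L \<sqsubseteq> A j" "j \<in> {1..n}" for L j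
    unfolding T_def
    using that n_pos S(3)[OF that(1,2)]
    by (intro parallel_limit_greatest[OF fin S(1) pos, where K = n]) auto
  have eq: "positive_lower_bounds (A ` {1..n}) = positive_lower_bounds (T ` {1..n})"
  proof -
    have "L \<sqsubseteq> A j" if "L \<sqsubseteq> T j" "j \<in> {1..n}" for L j
      using that T(2)[of j] order_trans unfolding loewner_le_def by blast
    then show ?thesis using LT by (auto simp: positive_lower_bounds_def)
  qed
  have "is_infimum G (T ` {1..n})" if "is_greatest_element G (positive_lower_bounds (T ` {1..n}))" for G
  proof (rule greatest_positive_imp_infimum[OF fin _ T(1) S(1) _ _ that])
    show "1 \<in> {1..n}" using n_pos by simp
    show "S \<sqsubseteq> T j" if "j \<in> {1..n}" for j using LT S that by blast
    show "quad (T j) u = 0" if "j \<in> {1..n}" "quad S u = 0" for j u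
      using parallel_limit_null[OF fin S(1) pos] that by (simp add: T_def)
  qed auto
  moreover have "is_greatest_element G (positive_lower_bounds (T ` {1..n}))"
    if "is_infimum G (T ` {1..n})" for G
    using infimum_imp_greatest_positive[OF that] T(1) by blast
  ultimately show ?thesis
    unfolding eq T_def[symmetric] by blast
qed

end
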